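(* For all positive integers $n$ and $k$, $$f^*(n,k) = \left(1 + \frac{1}{2} + \cdots + \frac{1}{n}\right) k.$$ Consequently, for fixed $n$ and $k \to \infty$, $$f(n,k) = \left(1 + \frac{1}{2} + \cdots + \frac{1}{n} + o(1)\right) k.$$
   Context: Let $Q^n = \{0,1\}^n \subset \mathbb{R}^n$ denote the vertices of the $n$-cube. For positive integers $n, k$, an almost $k$-cover of $Q^n$ is a finite collection (multiset, repetitions allowed and counted with multiplicity) of affine hyperplanes in $\mathbb{R}^n$ such that every vertex of $Q^n \setminus \{\vec{0}\}$ lies in at least $k$ members of the collection (counted with multiplicity), and $\vec{0} = (0,\dots,0)$ lies in none of them. $f(n,k)$ denotes the minimum number of affine hyperplanes (counted with multiplicity) in an almost $k$-cover of $Q^n$. A fractional almost $k$-cover of $Q^n$ is an assignment of a non-negative real weight $w(H)$ to every affine hyperplane $H$ in $\mathbb{R}^n$ such that $\sum_{H \ni \vec{v}} w(H) \ge k$ for every $\vec{v} \in Q^n \setminus \{\vec{0}\}$, and $\sum_{H \ni \vec{0}} w(H) = 0$. $f^*(n,k)$ denotes the minimum of the total weight $\sum_H w(H)$ over all fractional almost $k$-covers $w$ of $Q^n$. *)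

theory Defs
  imports "HOL-Analysis.Analysis" "HOL-Library.Landau_Symbols" "HOL-Library.Multiset"
begin

text \<open>
  The ambient space is \<open>real ^ 'n\<close>, so that the dimension of the cube is \<open>CARD('n)\<close>, which ranges
  over all positive integers as \<open>'n\<close> ranges over all finite types.
\<close>

definition cube :: "(real ^ 'n::finite) set" where
  "cube = {x. \<forall>i. x $ i = 0 \<or> x $ i = 1}"

definition hyperplanes :: "(real ^ 'n::finite) set set" where
  "hyperplanes = {H. \<exists>a b. a \<noteq> 0 \<and> H = {x. a \<bullet> x = b}}"

definition almost_cover :: "nat \<Rightarrow> (real ^ 'n::finite) set multiset \<Rightarrow> bool" where
  "almost_cover k C \<longleftrightarrow>
     set_mset C \<subseteq> hyperplanes \<and>
     (\<forall>v \<in> cube - {0}. k \<le> size {#H \<in># C. v \<in> H#}) \<and>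
     (\<forall>H \<in># C. 0 \<notin> H)"

text \<open>The type argument carries the dimension of the cube.\<close>

definition cover_number :: "'n::finite itself \<Rightarrow> nat \<Rightarrow> nat" where
  "cover_number _ k = (LEAST m. \<exists>C :: (real ^ 'n) set multiset. almost_cover k C \<and> size C = m)"

text \<open>
  A weight function may have uncountable support, so the weights, which are non-negative reals,
  are summed in the extended non-negative reals, where every sum exists. The values of \<open>w\<close> on sets
  that are not hyperplanes are never used.
\<close>

definition weight_through :: "((real ^ 'n::finite) set \<Rightarrow> real) \<Rightarrow> real ^ 'n \<Rightarrow> ennreal" where
  "weight_through w v = (\<Sum>\<^sub>\<infinity>H \<in> {H \<in> hyperplanes. v \<in> H}. ennreal (w H))"

definition total_weight :: "((real ^ 'n::finite) set \<Rightarrow> real) \<Rightarrow> ennreal" where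
  "total_weight w = (\<Sum>\<^sub>\<infinity>H \<in> hyperplanes. ennreal (w H))"

definition fractional_almost_cover :: "nat \<Rightarrow> ((real ^ 'n::finite) set \<Rightarrow> real) \<Rightarrow> bool" where
  "fractional_almost_cover k w \<longleftrightarrow>
     (\<forall>H \<in> hyperplanes. 0 \<le> w H) \<and>
     (\<forall>v \<in> cube - {0}. of_nat k \<le> weight_through w v) \<and>
     weight_through w 0 = 0"

text \<open>
  This is an infimum; that it is attained, hence a minimum, has to be stated separately.
\<close>

definition fractional_cover_number :: "'n::finite itself \<Rightarrow> nat \<Rightarrow> ennreal" where
  "fractional_cover_number _ k =
     Inf {total_weight w | w :: (real ^ 'n) set \<Rightarrow> real. fractional_almost_cover k w}"

text \<open>Almost covers exist, so the minimum in \<^const>\<open>cover_number\<close> is over a nonempty set.\<close>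

lemma almost_cover_exists: "\<exists>C :: (real ^ 'n::finite) set multiset. almost_cover k C"
proof -
  let ?h = "\<lambda>i::'n. {x :: real ^ 'n. x $ i = 1}"
  let ?C = "\<Sum>i\<in>UNIV. replicate_mset k (?h i)"
  have set_C: "set_mset ?C \<subseteq> range ?h"
    by (auto simp: set_mset_sum split: if_splits)
  have hyp: "?h i \<in> hyperplanes" for i
    unfolding hyperplanes_def
    by (intro CollectI exI[of _ "axis i 1"] exI[of _ 1])
       (auto simp: inner_axis' axis_eq_0_iff)
  have "k \<le> size {#H \<in># ?C. v \<in> H#}" if v: "v \<in> cube - {0}" for v
  proof -
    obtain i where i: "v $ i = 1"
      using v by (auto simp: cube_def vec_eq_iff)
    have "replicate_mset k (?h i) \<subseteq># ?C"
      by (subst sum.remove[of _ i]) auto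
    then have "{#H \<in># replicate_mset k (?h i). v \<in> H#} \<subseteq># {#H \<in># ?C. v \<in> H#}"
      by (rule multiset_filter_mono)
    moreover have "{#H \<in># replicate_mset k (?h i). v \<in> H#} = replicate_mset k (?h i)"
      using i by (induction k) auto
    ultimately show ?thesis
      using size_mset_mono by fastforce
  qed
  then have "almost_cover k ?C"
    unfolding almost_cover_def using set_C hyp by fastforce
  then show ?thesis ..
qed

lemma cover_number_attained:
  "\<exists>C :: (real ^ 'n::finite) set multiset. almost_cover k C \<and> size C = cover_number TYPE('n) k"
  unfolding cover_number_def by (rule LeastI_ex) (use almost_cover_exists in blast)

end

theory Submission
  imports Defs "HOL-Combinatorics.Multiset_Permutations"
begin

text \<open>
  The fractional problem is a linear program, and one family of weights solves both it and its dual.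
  Write \<open>q S = 1 / (|S| * (n choose |S|))\<close> for a nonempty set \<open>S\<close> of coordinates. Each size
  \<open>j\<close> contributes \<open>1 / j\<close> to the sum of all \<open>q S\<close>, so the total is the harmonic number
  of \<open>n\<close>.

  For the upper bound, \<open>k * q S\<close> is put on the hyperplane where the coordinates in \<open>S\<close> sum to 1.
  The vertex with support \<open>T\<close> lies on it exactly when \<open>S\<close> meets \<open>T\<close> once, and
  a telescoping sum of ratios of binomial coefficients shows that the \<open>q S\<close> of these sets add up
  to exactly 1 (\<open>sum_set_weight_meeting_once\<close>).

  For the lower bound, \<open>q S\<close> is put on the vertex with support \<open>S\<close>. By weak duality
  (\<open>harm_le_total_weight\<close>) it suffices that every hyperplane that misses the origin carries vertex
  weight at most 1 (\<open>hyperplane_set_weight_le_1\<close>). This is an inequality of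
  Lubell-Yamamoto-Meshalkin type. Normalise the hyperplane to \<open>a \<bullet> x = b\<close> with \<open>b > 0\<close>, and
  count those orderings of the coordinates whose partial sums of \<open>a\<close> reach the value \<open>b\<close>
  after exactly the elements of \<open>S\<close>, all earlier partial sums being less than \<open>b\<close>.
  Different \<open>S\<close> yield disjoint sets of orderings. By the cycle lemma every cyclic
  arrangement of \<open>S\<close> has a rotation with this property, so \<open>S\<close> owns at least
  \<open>(|S| - 1)! * (n - |S|)!\<close> orderings, which is a fraction \<open>q S\<close> of all of them.

  For integral covers, multiplicities are a fractional cover, and rounding the optimal weights up
  costs less than 1 for each of the fewer than \<open>2 ^ n\<close> hyperplanes used. Hence the integral
  optimum lies within the constant \<open>2 ^ n\<close> of the fractional one.
\<close>

section \<open>Orderings that reach their total only at the end\<close>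

text \<open>
  The cycle lemma: starting the rotation at the first place where the prefix sum of \<open>xs\<close> is
  largest works. Up to the end of \<open>xs\<close>, no increment over that maximum is positive; after wrapping
  around, the sum is the total minus the gap to a strictly smaller earlier prefix sum.
\<close>

lemma ex_rotation_prefix_sums_less:
  fixes xs :: "real list"
  assumes "0 < sum_list xs"
  shows "\<exists>k<length xs. \<forall>j<length xs. sum_list (take j (rotate k xs)) < sum_list xs"
proof -
  define n where "n = length xs"
  define P where "P j = sum_list (take j xs)" for j
  have "n > 0" using assms by (auto simp: n_def)
  define M where "M = Max (P ` {..<n})"
  have le_M: "P j \<le> M" if "j < n" for j
    unfolding M_def using that by (intro Max_ge) auto
  have "M \<in> P ` {..<n}"
    unfolding M_def using \<open>n > 0\<close> by (intro Max_in) auto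
  then have ex: "\<exists>k. k < n \<and> P k = M" by auto
  define k where "k = (LEAST k. k < n \<and> P k = M)"
  have k: "k < n" "P k = M"
    using LeastI_ex[OF ex] by (auto simp: k_def)
  have before_k: "P j < P k" if "j < k" for j
  proof -
    have "P j \<noteq> M"
      using not_less_Least[OF that[unfolded k_def]] that k by auto
    then show ?thesis using le_M[of j] that k by simp
  qed
  have rot: "rotate k xs = drop k xs @ take k xs"
    using k by (simp add: rotate_drop_take n_def)
  have drop_sum: "sum_list (take i (drop k xs)) = P (k + i) - P k" for i
    using arg_cong[OF take_add[of k i xs], of sum_list] by (simp add: P_def)
  have total: "P n = sum_list xs" by (simp add: P_def n_def)
  have "sum_list (take j (rotate k xs)) < sum_list xs" if "j < n" for j
  proof (cases "j < n - k")
    case True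
    then have "sum_list (take j (rotate k xs)) = P (k + j) - P k"
      by (simp add: rot drop_sum n_def)
    then show ?thesis using le_M[of "k + j"] True k assms by simp linarith
  next
    case False
    define i where "i = j - (n - k)"
    have "i < k" using False that k by (auto simp: i_def)
    have "sum_list (take j (rotate k xs)) = sum_list (drop k xs) + P i"
      using False \<open>i < k\<close> by (simp add: rot i_def n_def P_def min_def)
    also have "sum_list (drop k xs) = sum_list xs - P k"
      using drop_sum[of "n - k"] k total by (simp add: n_def)
    finally show ?thesis using before_k[OF \<open>i < k\<close>] by simp
  qed
  then show ?thesis using k n_def by auto
qed

definition first_passage_perms :: "('a \<Rightarrow> real) \<Rightarrow> 'a set \<Rightarrow> 'a list set" where
  "first_passage_perms a S =
     {xs \<in> permutations_of_set S. \<forall>j<length xs. sum_list (take j (map a xs)) < sum a S}"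

lemma sum_list_map_permutation:
  "xs \<in> permutations_of_set S \<Longrightarrow> sum_list (map a xs) = sum a S"
  by (auto simp: permutations_of_set_def sum_list_distinct_conv_sum_set)

text \<open>
  Every ordering of \<open>S\<close> is a rotation, by one of \<open>|S|\<close> amounts, of a first-passage ordering.
\<close>

lemma fact_le_card_first_passage_perms:
  assumes "finite S" "0 < sum a S"
  shows "fact (card S - 1) \<le> card (first_passage_perms a S)"
proof -
  let ?G = "first_passage_perms a S"
  have fin: "finite ?G" by (simp add: first_passage_perms_def)
  have "S \<noteq> {}" using assms by auto
  then have pos: "card S > 0" using assms by (simp add: card_gt_0_iff)
  have "permutations_of_set S \<subseteq> (\<lambda>(k, xs). rotate k xs) ` ({..<card S} \<times> ?G)"
  proof
    fix xs assume xs: "xs \<in> permutations_of_set S"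
    have len: "length xs = card S" using xs by (rule length_finite_permutations_of_set)
    have tot: "sum_list (map a xs) = sum a S" using xs by (rule sum_list_map_permutation)
    obtain k where k: "k < card S"
      "\<And>j. j < card S \<Longrightarrow> sum_list (take j (rotate k (map a xs))) < sum a S"
      using ex_rotation_prefix_sums_less[of "map a xs"] assms tot len by auto
    have G: "rotate k xs \<in> ?G"
      using xs k len by (auto simp: first_passage_perms_def permutations_of_set_def rotate_map)
    \<comment> \<open>Rotating by \<open>l\<close> undoes the rotation by \<open>k\<close>; the case \<open>k = 0\<close> is separate to keep \<open>l < card S\<close>.\<close>
    define l where "l = (if k = 0 then 0 else card S - k)"
    have "rotate l (rotate k xs) = xs"
    proof (cases "k = 0")
      case True then show ?thesis by (simp add: l_def)
    next
      case False
      then have "l + k = length xs" using k len by (simp add: l_def)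
      then show ?thesis by (simp add: rotate_rotate)
    qed
    moreover have "l < card S" using k by (auto simp: l_def)
    ultimately show "xs \<in> (\<lambda>(k, xs). rotate k xs) ` ({..<card S} \<times> ?G)"
      using G by (intro image_eqI[of _ _ "(l, rotate k xs)"]) auto
  qed
  then have "card (permutations_of_set S) \<le> card ({..<card S} \<times> ?G)"
    by (rule surj_card_le[rotated]) (use fin in auto)
  then have "fact (card S) \<le> card S * card ?G"
    using assms by (simp add: card_cartesian_product)
  moreover have "fact (card S) = card S * fact (card S - 1)"
    using pos by (simp add: fact_reduce)
  ultimately show ?thesis using pos by simp
qed

text \<open>
  An ordering of \<open>V\<close> that starts with a first-passage ordering of \<open>S\<close> determines \<open>S\<close>:
  it is the set of entries read when the partial sums of \<open>a\<close> reach \<open>b\<close> for the first time. So the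
  summands count parts of disjoint sets of orderings of \<open>V\<close>.
\<close>

lemma sum_fact_subsets_of_sum_le:
  fixes a :: "'a \<Rightarrow> real"
  assumes V: "finite V" and b: "0 < b"
  shows "(\<Sum>S | S \<subseteq> V \<and> sum a S = b. fact (card S - 1) * fact (card V - card S)) \<le> (fact (card V) :: nat)"
proof -
  define F where "F S = (\<lambda>(xs, ys). xs @ ys) ` (first_passage_perms a S \<times> permutations_of_set (V - S))" for S
  let ?I = "{S. S \<subseteq> V \<and> sum a S = b}"
  have finI: "finite ?I" using V by simp
  have finS: "finite S" if "S \<in> ?I" for S using that V finite_subset by auto
  have fin: "finite (first_passage_perms a S)" for S
    by (simp add: first_passage_perms_def)
  have len: "length xs = card S" if "xs \<in> first_passage_perms a S" for xs S
    using that by (auto simp: first_passage_perms_def length_finite_permutations_of_set)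
  have card_F: "fact (card S - 1) * fact (card V - card S) \<le> card (F S)" if S: "S \<in> ?I" for S
  proof -
    have inj: "inj_on (\<lambda>(xs, ys). xs @ ys) (first_passage_perms a S \<times> permutations_of_set (V - S))"
    proof (rule inj_on_inverseI)
      fix p assume "p \<in> first_passage_perms a S \<times> permutations_of_set (V - S)"
      then have "length (fst p) = card S" using len by auto
      then show "(\<lambda>zs. (take (card S) zs, drop (card S) zs)) (case p of (xs, ys) \<Rightarrow> xs @ ys) = p"
        by (simp add: case_prod_unfold)
    qed
    have "card (F S) = card (first_passage_perms a S) * card (permutations_of_set (V - S))"
      unfolding F_def using inj by (simp add: card_image card_cartesian_product)
    also have "card (permutations_of_set (V - S)) = fact (card V - card S)"
      using S V finS[OF S] by (simp add: card_Diff_subset)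
    finally have "card (F S) = card (first_passage_perms a S) * fact (card V - card S)" .
    moreover have "fact (card S - 1) \<le> card (first_passage_perms a S)"
      using S b finS[OF S] by (intro fact_le_card_first_passage_perms) simp_all
    ultimately show ?thesis by (metis mult_le_mono1)
  qed
  have no_overtake: False
    if "xs \<in> first_passage_perms a S" "xs' \<in> first_passage_perms a S'"
       "S \<in> ?I" "S' \<in> ?I" "xs @ ys = xs' @ ys'" "length xs < length xs'" for xs xs' ys ys' S S'
  proof -
    have "take (length xs) xs' = xs"
      using arg_cong[OF that(5), of "take (length xs)"] that(6) by simp
    then have "sum_list (take (length xs) (map a xs')) = b"
      using that(1,3) sum_list_map_permutation[of xs S a]
      by (auto simp: take_map first_passage_perms_def)
    moreover have "sum_list (take (length xs) (map a xs')) < sum a S'"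
      using that(2,6) by (simp add: first_passage_perms_def)
    ultimately show False using that(4) by simp
  qed
  have disj: "F S \<inter> F S' = {}" if "S \<in> ?I" "S' \<in> ?I" "S \<noteq> S'" for S S'
  proof -
    have False if zs: "zs \<in> F S" "zs \<in> F S'" for zs
    proof -
      obtain xs ys where 1: "zs = xs @ ys" "xs \<in> first_passage_perms a S"
        using zs(1) by (auto simp: F_def)
      obtain xs' ys' where 2: "zs = xs' @ ys'" "xs' \<in> first_passage_perms a S'"
        using zs(2) by (auto simp: F_def)
      have "length xs = length xs'"
      proof (rule linorder_cases)
        show "length xs = length xs'" if "length xs < length xs'"
          using no_overtake[OF 1(2) 2(2) \<open>S \<in> ?I\<close> \<open>S' \<in> ?I\<close> _ that] 1(1) 2(1) by blast
        show "length xs = length xs'" if "length xs' < length xs"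
          using no_overtake[OF 2(2) 1(2) \<open>S' \<in> ?I\<close> \<open>S \<in> ?I\<close> _ that] 1(1) 2(1) by metis
      qed
      then have "xs = xs'" using 1 2 by simp
      then have "S = S'" using 1 2
        by (auto simp: first_passage_perms_def permutations_of_set_def)
      then show False using \<open>S \<noteq> S'\<close> by simp
    qed
    then show ?thesis by blast
  qed
  have "(\<Sum>S\<in>?I. fact (card S - 1) * fact (card V - card S)) \<le> (\<Sum>S\<in>?I. card (F S))"
    by (intro sum_mono card_F)
  also have "\<dots> = card (\<Union>S\<in>?I. F S)"
    using finI disj fin by (intro card_UN_disjoint[symmetric]) (auto simp: F_def)
  also have "\<dots> \<le> card (permutations_of_set V)"
  proof (intro card_mono)
    show "(\<Union>S\<in>?I. F S) \<subseteq> permutations_of_set V"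
      by (auto simp: F_def first_passage_perms_def permutations_of_set_def)
  qed simp
  finally show ?thesis using V by simp
qed

section \<open>A self-dual weight on nonempty sets\<close>

definition set_weight :: "'n::finite set \<Rightarrow> real" where
  "set_weight S = 1 / (card S * (CARD('n) choose card S))"

lemma set_weight_nonneg: "0 \<le> set_weight S"
  by (simp add: set_weight_def)

text \<open>
  In this form \<open>set_weight S\<close> is the share of the orderings of all coordinates that the counting
  argument grants to \<open>S\<close>.
\<close>

lemma set_weight_eq_fact:
  fixes S :: "'n::finite set"
  assumes "S \<noteq> {}"
  shows "set_weight S = fact (card S - 1) * fact (CARD('n) - card S) / fact CARD('n)"
proof -
  have le: "card S \<le> CARD('n)" by (rule card_mono) auto
  have pos: "0 < card S" using assms by (simp add: card_gt_0_iff)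
  have f: "(fact (card S) :: real) = card S * fact (card S - 1)"
    using pos by (simp add: fact_reduce)
  show ?thesis
    using assms by (simp add: set_weight_def binomial_fact[OF le] f)
qed

lemma sum_Pow_card:
  fixes g :: "nat \<Rightarrow> real"
  assumes "finite A"
  shows "(\<Sum>S\<in>Pow A. g (card S)) = (\<Sum>i\<le>card A. (card A choose i) * g i)"
proof -
  have "(\<Sum>S\<in>Pow A. g (card S)) = (\<Sum>i\<le>card A. \<Sum>S | S \<in> Pow A \<and> card S = i. g (card S))"
    using assms by (intro sum.group[symmetric]) (auto intro: card_mono)
  also have "\<dots> = (\<Sum>i\<le>card A. (card A choose i) * g i)"
    using assms by (intro sum.cong) (simp_all add: n_subsets)
  finally show ?thesis .
qed

lemma sum_set_weight: "(\<Sum>S\<in>UNIV - {{}}. set_weight (S :: 'n::finite set)) = harm CARD('n)"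
proof -
  let ?n = "CARD('n)"
  have "(\<Sum>S\<in>UNIV - {{}}. set_weight (S :: 'n set)) = (\<Sum>S\<in>Pow UNIV. set_weight (S :: 'n set))"
    by (intro sum.mono_neutral_left) (auto simp: set_weight_def)
  also have "\<dots> = (\<Sum>i\<le>?n. (?n choose i) * (1 / (i * (?n choose i))))"
    unfolding set_weight_def using sum_Pow_card[of "UNIV :: 'n set" "\<lambda>i. 1 / (i * (?n choose i))"] by simp
  also have "\<dots> = (\<Sum>i\<le>?n. inverse (real i))"
    by (intro sum.cong) (auto simp: field_simps)
  also have "\<dots> = (\<Sum>i=1..?n. inverse (real i))"
    by (intro sum.mono_neutral_right) (auto simp: Suc_le_eq)
  finally show ?thesis by (simp add: harm_def)
qed

text \<open>
  If \<open>t i\<close> is the summand, then \<open>(M - i) * t (i + 1) = (N - i) * t i\<close>. Hence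
  \<open>(M + 1 - i) * t i\<close> drops by exactly \<open>(M + 1 - N) * t i\<close> when \<open>i\<close> grows by 1, and
  the sum telescopes.
\<close>

lemma sum_choose_ratio:
  assumes "N \<le> M"
  shows "(\<Sum>i\<le>N. (N choose i) / (M choose i)) = (M + 1) / (real M + 1 - real N)"
proof -
  define t :: "nat \<Rightarrow> real" where "t i = (N choose i) / (M choose i)" for i
  have step: "(real M - i) * t (Suc i) = (real N - i) * t i" if "i \<le> N" for i
  proof (cases "i = N")
    case True then show ?thesis by (simp add: t_def)
  next
    case False
    then have i: "i < N" "i < M" using that assms by auto
    have abs: "real (n - i) * (n choose i) = real (Suc i) * (n choose Suc i)" for n
    proof -
      have "(n - i) * (n choose i) = Suc i * (n choose Suc i)"
        using Suc_times_binomial_add[of i "n - Suc i"] binomial_symmetric[of i n]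
        by (metis binomial_absorb_comp binomial_absorption)
      then show ?thesis by (metis of_nat_mult)
    qed
    have pos: "(M choose i) > 0" "(M choose Suc i) > 0" using i by (auto simp: zero_less_binomial_iff)
    have "(real M - i) * (M choose i) * (N choose Suc i) = (real N - i) * (N choose i) * (M choose Suc i)"
      using abs[of M] abs[of N] i by (simp add: of_nat_diff)
    then show ?thesis using pos by (simp add: t_def field_simps)
  qed
  have tele: "(real M + 1 - real N) * (\<Sum>i<j. t i) = (real M + 1) - (real M + 1 - j) * t j"
    if "j \<le> Suc N" for j
    using that
  proof (induction j)
    case 0 then show ?case by (simp add: t_def)
  next
    case (Suc j)
    then show ?case using step[of j] by (simp add: algebra_simps)
  qed
  have "(real M + 1 - real N) * (\<Sum>i\<le>N. t i) = real M + 1"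
    using tele[of "Suc N"] by (simp add: lessThan_Suc_atMost t_def)
  moreover have "real M + 1 - real N > 0" using assms by simp
  ultimately show ?thesis by (simp add: t_def field_simps)
qed

text \<open>
  A set that meets \<open>T\<close> once consists of an element of \<open>T\<close> and a subset \<open>B\<close> of the complement of
  \<open>T\<close>. By absorption its weight is \<open>1 / (n * ((n - 1) choose |B|))\<close>, so grouping by \<open>|B|\<close> leaves
  a sum of ratios of binomial coefficients.
\<close>

lemma sum_set_weight_meeting_once:
  fixes T :: "'n::finite set"
  assumes "T \<noteq> {}"
  shows "(\<Sum>S | card (S \<inter> T) = 1. set_weight S) = 1"
proof -
  let ?n = "CARD('n)" and ?m = "card T"
  have m: "0 < ?m" "?m \<le> ?n" using assms by (auto simp: card_gt_0_iff intro: card_mono)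
  define g where "g i = 1 / (real ?n * ((?n - 1) choose i))" for i
  have w: "set_weight (insert t B) = g (card B)" if "t \<in> T" "B \<subseteq> - T" for t B
  proof -
    have "card (insert t B) = Suc (card B)" using that by (intro card_insert_disjoint) auto
    moreover have "real (Suc (card B)) * (?n choose Suc (card B)) = real ?n * ((?n - 1) choose card B)"
      using binomial_absorption[of "card B" ?n] by (metis of_nat_mult)
    ultimately show ?thesis by (simp only: set_weight_def g_def of_nat_mult)
  qed
  have "(\<Sum>S | card (S \<inter> T) = 1. set_weight S) = (\<Sum>(t, B)\<in>T \<times> Pow (- T). set_weight (insert t B))"
  proof (rule sum.reindex_bij_betw[symmetric, THEN trans])
    show "bij_betw (\<lambda>(t, B). insert t B) (T \<times> Pow (- T)) {S. card (S \<inter> T) = 1}"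
      unfolding bij_betw_def
    proof
      show "inj_on (\<lambda>(t, B). insert t B) (T \<times> Pow (- T))"
      proof (rule inj_on_inverseI)
        fix p assume "p \<in> T \<times> Pow (- T)"
        then have "(case p of (t, B) \<Rightarrow> insert t B) \<inter> T = {fst p}"
          "(case p of (t, B) \<Rightarrow> insert t B) - T = snd p" by auto
        then show "(\<lambda>S. (the_elem (S \<inter> T), S - T)) (case p of (t, B) \<Rightarrow> insert t B) = p" by simp
      qed
      show "(\<lambda>(t, B). insert t B) ` (T \<times> Pow (- T)) = {S. card (S \<inter> T) = 1}"
      proof (intro equalityI subsetI)
        fix S assume "S \<in> (\<lambda>(t, B). insert t B) ` (T \<times> Pow (- T))"
        then obtain t where "S \<inter> T = {t}" by fastforce
        then show "S \<in> {S. card (S \<inter> T) = 1}" by simp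
      next
        fix S assume "S \<in> {S. card (S \<inter> T) = 1}"
        then obtain t where "S \<inter> T = {t}" using card_1_singletonE by blast
        then show "S \<in> (\<lambda>(t, B). insert t B) ` (T \<times> Pow (- T))"
          by (intro image_eqI[of _ _ "(t, S - T)"]) auto
      qed
    qed
  qed (simp add: case_prod_unfold)
  also have "\<dots> = (\<Sum>t\<in>T. \<Sum>B\<in>Pow (- T). g (card B))"
    by (simp add: sum.cartesian_product[symmetric] w)
  also have "\<dots> = ?m * (\<Sum>i\<le>?n - ?m. ((?n - ?m) choose i) * g i)"
    by (simp add: sum_Pow_card Compl_eq_Diff_UNIV card_Diff_subset)
  also have "\<dots> = ?m / ?n * (\<Sum>i\<le>?n - ?m. ((?n - ?m) choose i) / ((?n - 1) choose i))"
    by (simp add: g_def sum_distrib_left mult.assoc)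
  also have "\<dots> = 1"
    using m by (subst sum_choose_ratio) (auto simp: of_nat_diff)
  finally show ?thesis .
qed

section \<open>Vertices and hyperplanes\<close>

definition vertex :: "'n::finite set \<Rightarrow> real ^ 'n" where
  "vertex S = (\<chi> i. if i \<in> S then 1 else 0)"

lemma vertex_nonzero_iff: "vertex S \<in> cube - {0} \<longleftrightarrow> S \<noteq> {}"
  by (auto simp: vertex_def cube_def vec_eq_iff)

lemma ex_vertex: "v \<in> cube - {0} \<Longrightarrow> \<exists>S. S \<noteq> {} \<and> v = vertex S"
  by (rule exI[of _ "{i. v $ i = 1}"]) (auto simp: vertex_def cube_def vec_eq_iff)

lemma inner_vertex: "a \<bullet> vertex S = (\<Sum>i\<in>S. a $ i)"
  by (simp add: inner_vec_def vertex_def if_distrib sum.If_cases cong: if_cong)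

text \<open>
  Feasibility of the dual solution. Since \<open>H\<close> misses the origin, its equation can be given a
  positive right-hand side, as the first-passage count requires.
\<close>

lemma hyperplane_set_weight_le_1:
  fixes H :: "(real ^ 'n::finite) set"
  assumes "H \<in> hyperplanes" "0 \<notin> H"
  shows "(\<Sum>S | S \<noteq> {} \<and> vertex S \<in> H. set_weight S) \<le> 1"
proof -
  obtain a0 b0 where H0: "H = {x. a0 \<bullet> x = b0}" using assms by (auto simp: hyperplanes_def)
  have "b0 \<noteq> 0" using assms H0 by auto
  then obtain a b where H: "H = {x. a \<bullet> x = b}" and b: "0 < b"
  proof (cases "b0 > 0")
    case False
    then have "H = {x. (- a0) \<bullet> x = - b0}" "0 < - b0" using H0 \<open>b0 \<noteq> 0\<close> by auto
    then show ?thesis using that by blast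
  qed (use that H0 in blast)
  have eq: "{S. S \<noteq> {} \<and> vertex S \<in> H} = {S. S \<subseteq> UNIV \<and> (\<Sum>i\<in>S. a $ i) = b}"
    using b by (auto simp: H inner_vertex)
  have "(\<Sum>S | S \<noteq> {} \<and> vertex S \<in> H. set_weight S)
      = (\<Sum>S | S \<noteq> {} \<and> vertex S \<in> H. real (fact (card S - 1) * fact (CARD('n) - card S))) / fact CARD('n)"
    unfolding sum_divide_distrib by (intro sum.cong) (auto simp: set_weight_eq_fact)
  also have "\<dots> \<le> real (fact CARD('n)) / fact CARD('n)"
    unfolding of_nat_sum[symmetric] eq
    by (intro divide_right_mono of_nat_mono sum_fact_subsets_of_sum_le b) auto
  finally show ?thesis by simp
qed

definition one_hyperplane :: "'n::finite set \<Rightarrow> (real ^ 'n) set" where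
  "one_hyperplane S = {x. vertex S \<bullet> x = 1}"

lemma one_hyperplane_in_hyperplanes: "S \<noteq> {} \<Longrightarrow> one_hyperplane S \<in> hyperplanes"
  unfolding hyperplanes_def one_hyperplane_def using vertex_nonzero_iff[of S] by blast

lemma zero_notin_one_hyperplane: "0 \<notin> one_hyperplane S"
  by (simp add: one_hyperplane_def)

lemma vertex_in_one_hyperplane_iff: "vertex T \<in> one_hyperplane S \<longleftrightarrow> card (S \<inter> T) = 1"
proof -
  have "vertex S \<bullet> vertex T = card (S \<inter> T)"
    by (simp add: inner_vertex) (simp add: vertex_def sum.If_cases Int_commute)
  then show ?thesis by (simp add: one_hyperplane_def)
qed

lemma inj_one_hyperplane: "inj one_hyperplane"
proof (rule injI)
  fix S S' :: "'a set" assume eq: "one_hyperplane S = one_hyperplane S'"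
  have "i \<in> R \<longleftrightarrow> vertex {i} \<in> one_hyperplane R" for i and R :: "'a set"
    by (cases "i \<in> R") (auto simp: vertex_in_one_hyperplane_iff)
  then show "S = S'" using eq by blast
qed

section \<open>Weak duality and optimal covers\<close>

lemma infsum_cmult_ennreal:
  fixes f :: "'a \<Rightarrow> ennreal"
  assumes "c < top"
  shows "(\<Sum>\<^sub>\<infinity>x\<in>A. c * f x) = c * infsum f A"
proof (rule infsumI)
  have "(f has_sum infsum f A) A" by (intro has_sum_infsum nonneg_summable_on_complete) simp
  then show "((\<lambda>x. c * f x) has_sum c * infsum f A) A"
    using assms unfolding has_sum_def sum_distrib_left[symmetric] by (intro ennreal_tendsto_cmult)
qed

lemma infsum_sum_ennreal:
  fixes f :: "'b \<Rightarrow> 'a \<Rightarrow> ennreal"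
  assumes "finite I"
  shows "(\<Sum>\<^sub>\<infinity>x\<in>A. \<Sum>i\<in>I. f i x) = (\<Sum>i\<in>I. infsum (f i) A)"
  using assms by (induction I) (simp_all add: infsum_add nonneg_summable_on_complete)

text \<open>
  Weak duality: weight the covering constraint of each vertex by its dual weight, add up, and
  exchange the sums. Hyperplanes through the origin, which the dual bound does not concern, have
  weight 0.
\<close>

lemma harm_le_total_weight:
  fixes w :: "(real ^ 'n::finite) set \<Rightarrow> real"
  assumes w: "fractional_almost_cover k w"
  shows "ennreal (harm CARD('n) * real k) \<le> total_weight w"
proof -
  let ?I = "UNIV - {{}} :: 'n set set"
  have nonneg: "0 \<le> w H" if "H \<in> hyperplanes" for H
    using w that by (simp add: fractional_almost_cover_def)
  have zero: "w H = 0" if H: "H \<in> hyperplanes" "0 \<in> H" for H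
  proof -
    have "(\<Sum>\<^sub>\<infinity>G\<in>{H}. ennreal (w G)) \<le> weight_through w 0"
      unfolding weight_through_def by (rule infsum_mono_neutral) (use H in \<open>auto intro: nonneg_summable_on_complete\<close>)
    then show ?thesis using w nonneg H by (simp add: fractional_almost_cover_def ennreal_eq_0_iff order_antisym)
  qed
  have "ennreal (harm CARD('n) * real k) = (\<Sum>S\<in>?I. ennreal (set_weight S) * of_nat k)"
    by (simp add: sum_set_weight[symmetric] sum_distrib_right[symmetric] ennreal_mult'' sum_ennreal
        set_weight_nonneg sum_nonneg ennreal_of_nat_eq_real_of_nat)
  also have "\<dots> \<le> (\<Sum>S\<in>?I. ennreal (set_weight S) * weight_through w (vertex S))"
    using w vertex_nonzero_iff
    by (intro sum_mono mult_left_mono) (auto simp: fractional_almost_cover_def simp del: Diff_iff)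
  also have "\<dots> = (\<Sum>S\<in>?I. \<Sum>\<^sub>\<infinity>H\<in>hyperplanes. if vertex S \<in> H then ennreal (set_weight S * w H) else 0)"
    unfolding weight_through_def
    by (subst infsum_cmult_ennreal[symmetric])
       (auto intro!: sum.cong infsum_cong_neutral simp: ennreal_mult' set_weight_nonneg split: if_splits)
  also have "\<dots> = (\<Sum>\<^sub>\<infinity>H\<in>hyperplanes. \<Sum>S\<in>?I. if vertex S \<in> H then ennreal (set_weight S * w H) else 0)"
    by (rule infsum_sum_ennreal[symmetric]) simp
  also have "\<dots> \<le> total_weight w"
    unfolding total_weight_def
  proof (rule infsum_mono)
    fix H :: "(real ^ 'n) set" assume H: "H \<in> hyperplanes"
    have "(\<Sum>S\<in>?I. if vertex S \<in> H then ennreal (set_weight S * w H) else 0)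
        = (\<Sum>S | S \<noteq> {} \<and> vertex S \<in> H. ennreal (set_weight S * w H))"
      by (simp add: sum.If_cases) (intro sum.cong; auto)
    also have "\<dots> = ennreal ((\<Sum>S | S \<noteq> {} \<and> vertex S \<in> H. set_weight S) * w H)"
      using nonneg[OF H] by (simp add: sum_distrib_right set_weight_nonneg sum_ennreal)
    also have "\<dots> \<le> ennreal (w H)"
    proof (rule ennreal_leI, cases "0 \<in> H")
      case False
      then show "(\<Sum>S | S \<noteq> {} \<and> vertex S \<in> H. set_weight S) * w H \<le> w H"
        using hyperplane_set_weight_le_1[OF H] nonneg[OF H] by (simp add: mult_left_le_one_le sum_nonneg set_weight_nonneg)
    qed (use zero H in simp)
    finally show "(\<Sum>S\<in>?I. if vertex S \<in> H then ennreal (set_weight S * w H) else 0) \<le> ennreal (w H)" .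
  qed (auto intro: nonneg_summable_on_complete)
  finally show ?thesis .
qed

lemma ex_optimal_fractional_cover:
  "\<exists>w :: (real ^ 'n::finite) set \<Rightarrow> real.
     fractional_almost_cover k w \<and> total_weight w = ennreal (harm CARD('n) * real k)"
proof -
  let ?I = "UNIV - {{}} :: 'n set set"
  define w :: "(real ^ 'n) set \<Rightarrow> real" where
    "w H = (if H \<in> one_hyperplane ` ?I then k * set_weight (inv one_hyperplane H) else 0)" for H
  have w_one: "w (one_hyperplane S) = k * set_weight S" if "S \<noteq> {}" for S
    using that by (auto simp: w_def inj_one_hyperplane)
  have restrict: "(\<Sum>\<^sub>\<infinity>H\<in>{H \<in> hyperplanes. P H}. ennreal (w H))
      = ennreal (k * (\<Sum>S | S \<noteq> {} \<and> P (one_hyperplane S). set_weight S))" for P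
  proof -
    let ?J = "{S. S \<noteq> {} \<and> P (one_hyperplane S)}"
    have "(\<Sum>\<^sub>\<infinity>H\<in>{H \<in> hyperplanes. P H}. ennreal (w H)) = (\<Sum>\<^sub>\<infinity>H\<in>one_hyperplane ` ?J. ennreal (w H))"
    proof (rule infsum_cong_neutral)
      show "ennreal (w H) = 0" if "H \<in> {H \<in> hyperplanes. P H} - one_hyperplane ` ?J" for H
      proof -
        have "H \<notin> one_hyperplane ` ?I" using that by blast
        then show ?thesis by (simp add: w_def)
      qed
    next
      have "one_hyperplane ` ?J \<subseteq> {H \<in> hyperplanes. P H}"
        using one_hyperplane_in_hyperplanes by blast
      then show "ennreal (w H) = 0" if "H \<in> one_hyperplane ` ?J - {H \<in> hyperplanes. P H}" for H
        using that by blast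
    qed simp
    also have "\<dots> = (\<Sum>S\<in>?J. ennreal (w (one_hyperplane S)))"
      using inj_on_subset[OF inj_one_hyperplane subset_UNIV, of ?J] by (simp add: sum.reindex)
    also have "\<dots> = ennreal (\<Sum>S\<in>?J. k * set_weight S)"
      by (simp add: w_one sum_ennreal set_weight_nonneg)
    finally show ?thesis by (simp add: sum_distrib_left)
  qed
  have "fractional_almost_cover k w"
    unfolding fractional_almost_cover_def
  proof (intro conjI ballI)
    show "0 \<le> w H" for H by (simp add: w_def set_weight_nonneg)
    show "weight_through w 0 = 0"
      unfolding weight_through_def restrict by (simp add: zero_notin_one_hyperplane)
  next
    fix v :: "real ^ 'n" assume "v \<in> cube - {0}"
    then obtain T where T: "T \<noteq> {}" "v = vertex T" using ex_vertex by blast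
    have "{S. S \<noteq> {} \<and> vertex T \<in> one_hyperplane S} = {S. card (S \<inter> T) = 1}"
      by (auto simp: vertex_in_one_hyperplane_iff)
    then show "of_nat k \<le> weight_through w v"
      unfolding weight_through_def restrict T(2)
      using sum_set_weight_meeting_once[OF T(1)] by (simp add: ennreal_of_nat_eq_real_of_nat)
  qed
  moreover have "total_weight w = ennreal (harm CARD('n) * real k)"
    unfolding total_weight_def using restrict[of "\<lambda>_. True"] sum_set_weight[where 'n = 'n]
    by (simp add: set_diff_eq mult.commute)
  ultimately show ?thesis by blast
qed

lemma harm_le_cover_number:
  "harm CARD('n) * real k \<le> cover_number TYPE('n::finite) k"
proof -
  obtain C :: "(real ^ 'n) set multiset"
    where C: "almost_cover k C" "size C = cover_number TYPE('n) k"
    using cover_number_attained by blast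
  define w where "w H = real (count C H)" for H
  have count: "(\<Sum>\<^sub>\<infinity>H\<in>{H \<in> hyperplanes. P H}. ennreal (w H)) = of_nat (size {#H \<in># C. P H#})" for P
  proof -
    have "(\<Sum>\<^sub>\<infinity>H\<in>{H \<in> hyperplanes. P H}. ennreal (w H)) = (\<Sum>\<^sub>\<infinity>H\<in>set_mset {#H \<in># C. P H#}. ennreal (w H))"
      using C(1) by (intro infsum_cong_neutral) (auto simp: w_def almost_cover_def not_in_iff)
    also have "\<dots> = of_nat (\<Sum>H\<in>set_mset {#H \<in># C. P H#}. count {#H \<in># C. P H#} H)"
      by (simp add: w_def ennreal_of_nat_eq_real_of_nat[symmetric])
    finally show ?thesis by (simp only: size_multiset_overloaded_eq)
  qed
  have "fractional_almost_cover k w"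
    using C(1) unfolding fractional_almost_cover_def weight_through_def count
    by (auto simp: almost_cover_def w_def)
  then have "ennreal (harm CARD('n) * real k) \<le> total_weight w"
    by (rule harm_le_total_weight)
  also have "total_weight w = of_nat (size C)"
    unfolding total_weight_def using count[of "\<lambda>_. True"] by simp
  finally show ?thesis
    using C(2) by (simp add: ennreal_of_nat_eq_real_of_nat)
qed

text \<open>
  The weights of the optimal fractional cover are rounded up to multiplicities.
\<close>

lemma cover_number_le:
  "cover_number TYPE('n::finite) k \<le> harm CARD('n) * real k + 2 ^ CARD('n)"
proof -
  let ?I = "UNIV - {{}} :: 'n set set"
  define m where "m S = nat \<lceil>k * set_weight S\<rceil>" for S :: "'n set"
  have m_ge: "k * set_weight S \<le> m S" for S
    unfolding m_def by linarith
  have m_le: "m S \<le> k * set_weight S + 1" for S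
    using set_weight_nonneg[of S] by (simp add: m_def)
  define C :: "(real ^ 'n) set multiset" where
    "C = (\<Sum>S\<in>?I. replicate_mset (m S) (one_hyperplane S))"
  have set_C: "set_mset C \<subseteq> one_hyperplane ` ?I"
    by (auto simp: C_def set_mset_sum split: if_splits)
  have size_filter: "size {#H \<in># C. P H#} = (\<Sum>S | S \<noteq> {} \<and> P (one_hyperplane S). m S)" for P
  proof -
    have size_filter_replicate:
      "size {#H \<in># replicate_mset j G. P H#} = (if P G then j else 0)" for j G
      by (induction j) auto
    have "size {#H \<in># C. P H#} = (\<Sum>S\<in>?I. if P (one_hyperplane S) then m S else 0)"
    proof -
      have "size {#H \<in># (\<Sum>S\<in>J. replicate_mset (m S) (one_hyperplane S)). P H#}
          = (\<Sum>S\<in>J. if P (one_hyperplane S) then m S else 0)" if "finite J" for J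
        using that by (induction J) (simp_all add: size_filter_replicate)
      then show ?thesis by (simp add: C_def)
    qed
    also have "\<dots> = (\<Sum>S | S \<noteq> {} \<and> P (one_hyperplane S). m S)"
      by (simp add: sum.If_cases) (intro sum.cong; auto)
    finally show ?thesis .
  qed
  have "almost_cover k C"
    unfolding almost_cover_def
  proof (intro conjI ballI)
    show "set_mset C \<subseteq> hyperplanes" using set_C one_hyperplane_in_hyperplanes by auto
    show "0 \<notin> H" if "H \<in># C" for H using that set_C zero_notin_one_hyperplane by auto
  next
    fix v :: "real ^ 'n" assume "v \<in> cube - {0}"
    then obtain T where T: "T \<noteq> {}" "v = vertex T" using ex_vertex by blast
    have eq: "{S. S \<noteq> {} \<and> vertex T \<in> one_hyperplane S} = {S. card (S \<inter> T) = 1}"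
      by (auto simp: vertex_in_one_hyperplane_iff)
    have "real k = (\<Sum>S | card (S \<inter> T) = 1. k * set_weight S)"
      using sum_set_weight_meeting_once[OF T(1)] by (simp add: sum_distrib_left[symmetric])
    also have "\<dots> \<le> (\<Sum>S | card (S \<inter> T) = 1. real (m S))"
      by (intro sum_mono m_ge)
    finally have "real k \<le> real (size {#H \<in># C. v \<in> H#})"
      by (simp add: size_filter eq T(2))
    then show "k \<le> size {#H \<in># C. v \<in> H#}" by simp
  qed
  then have "cover_number TYPE('n) k \<le> size C"
    unfolding cover_number_def by (intro Least_le) blast
  also have "size C = (\<Sum>S\<in>?I. m S)"
    using size_filter[of "\<lambda>_. True"] by (simp add: set_diff_eq)
  also have "real (\<Sum>S\<in>?I. m S) \<le> (\<Sum>S\<in>?I. k * set_weight S + 1)"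
    unfolding of_nat_sum by (intro sum_mono m_le)
  also have "\<dots> = harm CARD('n) * k + card ?I"
    by (simp add: sum.distrib sum_distrib_left[symmetric] sum_set_weight)
  also have "card ?I \<le> card (UNIV :: 'n set set)"
    by (intro card_mono) auto
  also have "card (UNIV :: 'n set set) = 2 ^ CARD('n)"
    using card_Pow[of "UNIV :: 'n set"] by simp
  finally show ?thesis by simp
qed

theorem theorem1p2:
  "(\<forall>k>0. fractional_cover_number TYPE('n::finite) k = ennreal (harm CARD('n) * real k) \<and>
      (\<exists>w :: (real ^ 'n) set \<Rightarrow> real.
         fractional_almost_cover k w \<and> total_weight w = fractional_cover_number TYPE('n) k)) \<and>
   (\<exists>\<epsilon> :: nat \<Rightarrow> real. \<epsilon> \<in> o(\<lambda>_. 1) \<and>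
      (\<forall>k>0. real (cover_number TYPE('n) k) = (harm CARD('n) + \<epsilon> k) * real k))"
proof
  have "fractional_cover_number TYPE('n) k = ennreal (harm CARD('n) * real k)" for k
    unfolding fractional_cover_number_def
  proof (rule antisym)
    show "Inf {total_weight w | w :: (real ^ 'n) set \<Rightarrow> real. fractional_almost_cover k w}
        \<le> ennreal (harm CARD('n) * real k)"
      using ex_optimal_fractional_cover[where 'n = 'n and k = k] by (intro Inf_lower) force
    show "ennreal (harm CARD('n) * real k)
        \<le> Inf {total_weight w | w :: (real ^ 'n) set \<Rightarrow> real. fractional_almost_cover k w}"
      using harm_le_total_weight by (intro Inf_greatest) blast
  qed
  then show "\<forall>k>0. fractional_cover_number TYPE('n) k = ennreal (harm CARD('n) * real k) \<and>
      (\<exists>w :: (real ^ 'n) set \<Rightarrow> real.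
         fractional_almost_cover k w \<and> total_weight w = fractional_cover_number TYPE('n) k)"
    using ex_optimal_fractional_cover[where 'n = 'n] by simp
next
  define \<epsilon> where "\<epsilon> k = cover_number TYPE('n) k / real k - harm CARD('n)" for k
  have bounds: "0 \<le> \<epsilon> k \<and> \<epsilon> k \<le> 2 ^ CARD('n) / real k" if "k > 0" for k
  proof -
    have "\<epsilon> k = (cover_number TYPE('n) k - harm CARD('n) * real k) / real k"
      using that by (simp add: \<epsilon>_def diff_divide_distrib)
    then show ?thesis
      using that harm_le_cover_number[where 'n = 'n, of k] cover_number_le[where 'n = 'n, of k]
      by (auto intro: divide_right_mono)
  qed
  have "\<epsilon> \<longlonglongrightarrow> 0"
  proof (rule tendsto_sandwich)
    show "\<forall>\<^sub>F k in sequentially. 0 \<le> \<epsilon> k" "\<forall>\<^sub>F k in sequentially. \<epsilon> k \<le> 2 ^ CARD('n) / real k"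
      using eventually_gt_at_top[of 0] by (eventually_elim; use bounds in blast)+
  qed (auto intro: lim_const_over_n)
  then have "\<epsilon> \<in> o(\<lambda>_. 1)" by (intro smalloI_tendsto) auto
  moreover have "\<forall>k>0. real (cover_number TYPE('n) k) = (harm CARD('n) + \<epsilon> k) * real k"
    by (simp add: \<epsilon>_def)
  ultimately show "\<exists>\<epsilon> :: nat \<Rightarrow> real. \<epsilon> \<in> o(\<lambda>_. 1) \<and>
      (\<forall>k>0. real (cover_number TYPE('n) k) = (harm CARD('n) + \<epsilon> k) * real k)"
    by blast
qed

end
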